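(* Let $G$ be a finite simple undirected connected graph with at least five vertices, and let $\Delta(G)$ be the maximum degree of $G$. Then $$\lceil\log_2\Delta(G)\rceil\leq\mu(L(G))\leq |V(G)|-2.$$
   Context: $V(G)$ denotes the vertex set of $G$. The line graph $L(G)$ of $G$ is the graph whose vertices are the edges of $G$, two distinct edges of $G$ being adjacent in $L(G)$ if and only if they share an endpoint in $G$. For a connected graph $H$, $d_H(u,v)$ is the length of a shortest path between $u$ and $v$. A resolving set of $H$ is a set $W=\{w_1,\ldots,w_m\}$ of vertices such that each vertex $u$ of $H$ is uniquely determined by the vector $(d_H(u,w_1),\ldots,d_H(u,w_m))$, i.e. distinct vertices have distinct vectors. The metric dimension $\mu(H)$ is the minimum cardinality of a resolving set of $H$. *)

theory Defs
  imports Complex_Main "Graph_Theory.Graph_Theory"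
begin

(* Finite simple undirected graphs are the symmetric digraphs of locale graph: each edge uv
   is represented by the two arcs (u,v) and (v,u).  Hence the undirected edges are the
   two-element sets of end points. *)

definition edge_set :: "('a, 'b) pre_digraph \<Rightarrow> 'a set set" where
  "edge_set G = {{u, v} | u v. u \<rightarrow>\<^bsub>G\<^esub> v}"

definition line_graph :: "('a, 'b) pre_digraph \<Rightarrow> 'a set pair_pre_digraph" where
  "line_graph G = \<lparr> pverts = edge_set G,
     parcs = {(e, f). e \<in> edge_set G \<and> f \<in> edge_set G \<and> e \<noteq> f \<and> e \<inter> f \<noteq> {}} \<rparr>"

(* In a symmetric digraph without parallel arcs the number of arcs leaving v is the number of
   neighbours of v, i.e. its degree as a vertex of the undirected graph. *)
definition max_degree :: "('a, 'b) pre_digraph \<Rightarrow> nat" where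
  "max_degree G = Max (out_degree G ` verts G)"

(* Unspecified if there is no path from u to v. *)
definition graph_dist :: "('a, 'b) pre_digraph \<Rightarrow> 'a \<Rightarrow> 'a \<Rightarrow> nat" where
  "graph_dist H u v = (LEAST n. \<exists>p. pre_digraph.apath H u p v \<and> length p = n)"

(* The vector of distances to W is the function on W mapping w to the distance from u to w. *)
definition resolving_set :: "('a, 'b) pre_digraph \<Rightarrow> 'a set \<Rightarrow> bool" where
  "resolving_set H W \<longleftrightarrow> finite W \<and> W \<subseteq> verts H \<and>
     inj_on (\<lambda>u. \<lambda>w\<in>W. graph_dist H u w) (verts H)"

definition metric_dimension :: "('a, 'b) pre_digraph \<Rightarrow> nat" where
  "metric_dimension H = (LEAST m. \<exists>W. resolving_set H W \<and> card W = m)"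

lemma (in graph) line_graph_pair_graph: "pair_graph (line_graph G)"
proof -
  have "edge_set G \<subseteq> Pow (verts G)"
    by (auto simp: edge_set_def arcs_ends_conv)
  then have fin: "finite (edge_set G)"
    using finite_verts finite_subset by blast
  then have "finite (edge_set G \<times> edge_set G)" by simp
  then have fin2: "finite (parcs (line_graph G))"
    by (rule finite_subset[rotated]) (auto simp: line_graph_def)
  show ?thesis
    by unfold_locales
      (use fin fin2 in \<open>auto simp: line_graph_def symmetric_def sym_def\<close>)
qed

lemma graph_dist_self:
  assumes "v \<in> verts H"
  shows "graph_dist H v v = 0"
  unfolding graph_dist_def
  by (rule Least_equality)
    (use assms in \<open>auto simp: pre_digraph.apath_def pre_digraph.awalk_def
       pre_digraph.cas.simps pre_digraph.awalk_verts.simps\<close>)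

lemma (in graph) graph_dist_attained:
  assumes "Digraph_Component.connected G" "u \<in> verts G" "v \<in> verts G"
  shows "\<exists>p. apath u p v \<and> length p = graph_dist G u v"
proof -
  have "u \<rightarrow>\<^sup>* v"
    using assms by (simp add: connected_def
      strongly_connected_def reachable_mk_symmetric_eq[OF sym_arcs])
  then obtain p where "apath u p v" using reachable_apath by blast
  then show ?thesis
    unfolding graph_dist_def
    by (intro LeastI_ex[where P="\<lambda>n. \<exists>p. apath u p v \<and> length p = n"]) blast
qed

lemma (in graph) resolving_set_verts:
  assumes "Digraph_Component.connected G"
  shows "resolving_set G (verts G)"
proof -
  have "u = v" if uv: "u \<in> verts G" "v \<in> verts G"
    and eq: "(\<lambda>w\<in>verts G. graph_dist G u w) = (\<lambda>w\<in>verts G. graph_dist G v w)" for u v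
  proof -
    have "graph_dist G u v = 0"
      using fun_cong[OF eq, of v] uv(2) by (simp add: graph_dist_self)
    then obtain p where "apath u p v" "p = []"
      using graph_dist_attained[OF assms uv] by auto
    then show ?thesis by (simp add: apath_def awalk_def)
  qed
  then show ?thesis by (auto simp: resolving_set_def inj_on_def)
qed

end

theory Submission
  imports Defs
begin

text \<open>Lower bound: the edges at a vertex of maximum degree \<open>\<Delta>\<close> form a clique of the line graph,
  so their distances to any landmark take at most two values, and \<open>m\<close> landmarks separate at most
  \<open>2 ^ m\<close> of them.

  Upper bound: let \<open>F\<close> be the edge set of a tree on all but one of the \<open>n\<close> vertices, so
  \<open>|F| = n - 2\<close>. If two edges \<open>e, e' \<notin> F\<close> touch the same members of \<open>F\<close>, then their symmetric
  difference is a union of components of \<open>F\<close>. It has at least two elements, hence contains the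
  tree, and at most four, so \<open>n = 5\<close> and the tree has vertex set \<open>e \<union> e'\<close> with all its edges
  going between \<open>e\<close> and \<open>e'\<close>. Then it is a path with three edges, and together
  with \<open>e\<close> and \<open>e'\<close> it contains a star on the same four vertices; this star resolves, since every edge of \<open>G\<close> that joins two of the four vertices and contains the
  centre belongs to the star.\<close>

section \<open>Distances and metric dimension of a connected graph\<close>

context graph
begin

text \<open>Each reduction step replaces a walk \<open>q @ r @ s\<close> with a closed part
  \<open>r\<close> by \<open>q @ s\<close>. Hence \<open>graph_dist\<close>, which minimises over
  paths only, is bounded by the length of any walk.\<close>

lemma length_awalk_to_apath_le:
  assumes "awalk u p v"
  shows "length (awalk_to_apath p) \<le> length p"
  using assms
proof (induct rule: awalk_to_apath_induct)
  case (path p)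
  then have "awalk_to_apath p = p"
    by (auto simp: awalk_to_apath.simps)
  then show ?case by simp
next
  case (decomp p q r s)
  have "p = q @ r @ s"
    using decomp(2,1,3) by (rule awalk_cyc_decompE)
  moreover have "awalk_to_apath p = awalk_to_apath (q @ s)"
    using decomp step_awalk_to_apath[of _ p _ q r s] by simp
  ultimately show ?case using decomp by simp
qed

lemma graph_dist_le_awalk:
  assumes "awalk u p v"
  shows "graph_dist G u v \<le> length p"
proof -
  have "graph_dist G u v \<le> length (awalk_to_apath p)"
    unfolding graph_dist_def using apath_awalk_to_apath[OF assms] by (intro Least_le) blast
  then show ?thesis using length_awalk_to_apath_le[OF assms] by linarith
qed

lemma graph_dist_eq_0_iff:
  assumes "Digraph_Component.connected G" "u \<in> verts G" "v \<in> verts G"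
  shows "graph_dist G u v = 0 \<longleftrightarrow> u = v"
  using graph_dist_attained[OF assms] assms
  by (auto simp: graph_dist_self apath_def awalk_def)

lemma graph_dist_le_Suc:
  assumes "Digraph_Component.connected G" "u \<rightarrow>\<^bsub>G\<^esub> v" "w \<in> verts G"
  shows "graph_dist G u w \<le> Suc (graph_dist G v w)"
proof -
  have "v \<in> verts G" using assms(2) by (rule adj_in_verts)
  then obtain p where p: "apath v p w" "length p = graph_dist G v w"
    using graph_dist_attained assms by blast
  obtain a where "a \<in> arcs G" "tail G a = u" "head G a = v"
    using assms(2) by (auto simp: arcs_ends_conv)
  then have "awalk u (a # p) w"
    using p(1) by (simp add: awalk_Cons_iff apath_def)
  from graph_dist_le_awalk[OF this] show ?thesis using p(2) by simp
qed

lemma graph_dist_eq_1_iff: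
  assumes "Digraph_Component.connected G" "u \<in> verts G" "v \<in> verts G"
  shows "graph_dist G u v = 1 \<longleftrightarrow> u \<rightarrow>\<^bsub>G\<^esub> v"
proof
  assume "graph_dist G u v = 1"
  then obtain p where "apath u p v" "length p = 1"
    using graph_dist_attained[OF assms] by auto
  then show "u \<rightarrow>\<^bsub>G\<^esub> v"
    by (auto simp: length_Suc_conv apath_def awalk_simps arcs_ends_conv)
next
  assume uv: "u \<rightarrow>\<^bsub>G\<^esub> v"
  then have "graph_dist G u v \<le> 1"
    using graph_dist_le_Suc[OF assms(1) uv assms(3)] assms(3) by (simp add: graph_dist_self)
  moreover have "u \<noteq> v" using uv adj_not_same by blast
  then have "graph_dist G u v \<noteq> 0" using graph_dist_eq_0_iff[OF assms] by blast
  ultimately show "graph_dist G u v = 1" by linarith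
qed

lemma metric_dimension_attained:
  assumes "Digraph_Component.connected G"
  obtains W where "resolving_set G W" "card W = metric_dimension G"
  using LeastI_ex[where P = "\<lambda>m. \<exists>W. resolving_set G W \<and> card W = m"]
    resolving_set_verts[OF assms]
  unfolding metric_dimension_def by blast

lemma metric_dimension_le:
  "resolving_set G W \<Longrightarrow> metric_dimension G \<le> card W"
  unfolding metric_dimension_def by (rule Least_le) blast

lemma clique_card_le_power_metric_dimension:
  assumes conn: "Digraph_Component.connected G"
    and K: "K \<subseteq> verts G" "\<And>x y. x \<in> K \<Longrightarrow> y \<in> K \<Longrightarrow> x \<noteq> y \<Longrightarrow> x \<rightarrow>\<^bsub>G\<^esub> y"
  shows "card K \<le> 2 ^ metric_dimension G"
proof -
  obtain W where W: "resolving_set G W" "card W = metric_dimension G"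
    using metric_dimension_attained[OF conn] .
  then have fin: "finite W" and WG: "W \<subseteq> verts G"
    and inj: "inj_on (\<lambda>u. \<lambda>w\<in>W. graph_dist G u w) (verts G)"
    by (auto simp: resolving_set_def)
  \<comment> \<open>Distances from members of the clique to a fixed landmark differ by at most one,
    so such a distance is known once it is known whether it attains the minimum over
    \<open>K\<close>. The set \<open>near u\<close> collects the landmarks where \<open>u\<close>
    attains it, which encodes the distance vector as a subset of \<open>W\<close>.\<close>
  define near where "near u = {w \<in> W. \<forall>v\<in>K. graph_dist G u w \<le> graph_dist G v w}" for u
  have near_le: "graph_dist G u w \<le> graph_dist G v w"
    if u: "u \<in> K" and v: "v \<in> K" and eq: "near u = near v" and w: "w \<in> W" for u v w
  proof (cases "w \<in> near u")
    case True
    then show ?thesis using v by (simp add: near_def)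
  next
    case False
    then have "w \<notin> near v" using eq by simp
    then obtain x where x: "x \<in> K" "graph_dist G x w < graph_dist G v w"
      using w by (auto simp: near_def not_le)
    \<comment> \<open>Some \<open>x\<close> in the clique is strictly closer to \<open>w\<close>
      than \<open>v\<close>, and \<open>u\<close> is at most one step away from
      \<open>x\<close>.\<close>
    have "graph_dist G u w \<le> Suc (graph_dist G x w)"
      using graph_dist_le_Suc[OF conn K(2)[OF u x(1)], of w] w WG by (cases "u = x") auto
    then show ?thesis using x(2) by linarith
  qed
  have "inj_on near K"
  proof (rule inj_onI)
    fix u v assume uv: "u \<in> K" "v \<in> K" "near u = near v"
    have "(\<lambda>w\<in>W. graph_dist G u w) = (\<lambda>w\<in>W. graph_dist G v w)"
      using near_le[OF uv] near_le[OF uv(2,1) uv(3)[symmetric]]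
      by (intro restrict_ext order_antisym)
    then show "u = v" using inj uv K(1) by (auto dest: inj_onD)
  qed
  moreover have "near ` K \<subseteq> Pow W" by (auto simp: near_def)
  ultimately have "card K \<le> card (Pow W)"
    using fin by (metis card_inj_on_le finite_Pow_iff)
  then show ?thesis using W(2) fin by (simp add: card_Pow)
qed

section \<open>Cuts, edges and connectedness of the line graph\<close>

lemma reachable_if_connected:
  assumes "Digraph_Component.connected G" "u \<in> verts G" "v \<in> verts G"
  shows "u \<rightarrow>\<^sup>* v"
  using assms by (simp add: connected_def
    strongly_connected_def reachable_mk_symmetric_eq[OF sym_arcs])

lemma connectedI:
  assumes "verts G \<noteq> {}" "\<And>u v. u \<in> verts G \<Longrightarrow> v \<in> verts G \<Longrightarrow> u \<rightarrow>\<^sup>* v"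
  shows "Digraph_Component.connected G"
  using assms by (simp add: connected_def
    strongly_connected_def reachable_mk_symmetric_eq[OF sym_arcs])

text \<open>A path from a vertex of \<open>S\<close> to a vertex outside must leave \<open>S\<close>
  along some edge.\<close>

lemma connected_cut_edge:
  assumes "Digraph_Component.connected G" "S \<subset> verts G" "S \<noteq> {}"
  obtains a b where "a \<in> S" "b \<in> verts G" "b \<notin> S" "a \<rightarrow>\<^bsub>G\<^esub> b"
proof -
  obtain u v where uv: "u \<in> S" "v \<in> verts G" "v \<notin> S" using assms by blast
  have "u \<rightarrow>\<^sup>* v" using reachable_if_connected assms uv by blast
  then have "v \<in> S \<or> (\<exists>a b. a \<in> S \<and> b \<notin> S \<and> a \<rightarrow>\<^bsub>G\<^esub> b)"
    by (induct rule: reachable_induct) (use uv in blast)+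
  then show thesis using that uv(3) adj_in_verts by blast
qed

lemma edge_setE:
  assumes "e \<in> edge_set G"
  obtains u v where "e = {u, v}" "u \<noteq> v" "u \<rightarrow>\<^bsub>G\<^esub> v" "u \<in> verts G" "v \<in> verts G"
  using assms adj_not_same adj_in_verts unfolding edge_set_def by blast

lemma card_edge: "e \<in> edge_set G \<Longrightarrow> card e = 2"
  by (erule edge_setE) simp

lemma edge_subset_verts: "e \<in> edge_set G \<Longrightarrow> e \<subseteq> verts G"
  by (erule edge_setE) simp

lemma edge_set_nonempty:
  assumes "Digraph_Component.connected G" "card (verts G) \<ge> 2"
  shows "edge_set G \<noteq> {}"
proof -
  obtain v where "v \<in> verts G" using assms(2) by fastforce
  moreover have "verts G \<noteq> {v}" using assms(2) by auto
  ultimately obtain b where "v \<rightarrow>\<^bsub>G\<^esub> b"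
    using connected_cut_edge[OF assms(1), of "{v}"] by blast
  then show ?thesis by (auto simp: edge_set_def)
qed

lemma line_graph_adj_iff:
  "e \<rightarrow>\<^bsub>line_graph G\<^esub> f \<longleftrightarrow>
    e \<in> edge_set G \<and> f \<in> edge_set G \<and> e \<noteq> f \<and> e \<inter> f \<noteq> {}"
  by (auto simp: line_graph_def)

lemma pverts_line_graph: "pverts (line_graph G) = edge_set G"
  by (simp add: line_graph_def)

lemma line_graph_graph: "graph (line_graph G)"
  using line_graph_pair_graph by (rule pair_graph.pair_graphD_graph)

lemma line_graph_connected:
  assumes conn: "Digraph_Component.connected G" and "edge_set G \<noteq> {}"
  shows "Digraph_Component.connected (line_graph G)"
proof -
  interpret L: graph "with_proj (line_graph G)" by (rule line_graph_graph)
  have adj: "e \<rightarrow>\<^sup>*\<^bsub>line_graph G\<^esub> f"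
    if "e \<in> edge_set G" "f \<in> edge_set G" "x \<in> e" "x \<in> f" for e f x
  proof (cases "e = f")
    case True
    then show ?thesis using that by (simp add: L.reachable_refl pverts_line_graph)
  next
    case False
    then show ?thesis using that by (intro L.reachable_adjI iffD2[OF line_graph_adj_iff]) auto
  qed
  show ?thesis
  proof (rule L.connectedI)
    fix e f assume "e \<in> verts (line_graph G)" "f \<in> verts (line_graph G)"
    then have e: "e \<in> edge_set G" and f: "f \<in> edge_set G" by (auto simp: pverts_line_graph)
    obtain u where u: "u \<in> e" "u \<in> verts G" using e by (blast elim: edge_setE)
    obtain v where v: "v \<in> f" "v \<in> verts G" using f by (blast elim: edge_setE)
    have "u \<rightarrow>\<^sup>* v" using reachable_if_connected conn u v by blast
    \<comment> \<open>The claim covers all edges at the current vertex, so the induction along a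
      path of \<open>G\<close> can pass from \<open>x\<close> to \<open>y\<close> through the edge
      \<open>{x, y}\<close>.\<close>
    then have "\<forall>g\<in>edge_set G. v \<in> g \<longrightarrow> e \<rightarrow>\<^sup>*\<^bsub>line_graph G\<^esub> g"
    proof (induct rule: reachable_induct)
      case base
      then show ?case using adj e u by blast
    next
      case (step x y)
      have xy: "{x, y} \<in> edge_set G" using step by (auto simp: edge_set_def)
      then have "e \<rightarrow>\<^sup>*\<^bsub>line_graph G\<^esub> {x, y}" using step by blast
      then show ?case using adj[OF xy, of _ y] by (blast intro: L.reachable_trans)
    qed
    then show "e \<rightarrow>\<^sup>*\<^bsub>line_graph G\<^esub> f" using f v by blast
  qed (use assms in \<open>simp add: pverts_line_graph\<close>)
qed

section \<open>The clique of edges at a vertex and the maximum degree\<close>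

text \<open>Turns \<open>out_degree\<close>, which counts arcs, into a count of edges. The common
  tail matters: an arc and its reverse have the same set of ends.\<close>

lemma inj_on_arc_ends: "inj_on (\<lambda>a. {tail G a, head G a}) (out_arcs G v)"
proof (rule inj_onI)
  fix a b assume "a \<in> out_arcs G v" "b \<in> out_arcs G v"
    and "{tail G a, head G a} = {tail G b, head G b}"
  then show "a = b"
    by (intro no_multi_arcs) (auto simp: arc_to_ends_def doubleton_eq_iff)
qed

lemma out_degree_le_power_metric_dimension:
  assumes "Digraph_Component.connected (line_graph G)"
  shows "out_degree G v \<le> 2 ^ metric_dimension (line_graph G)"
proof -
  interpret L: graph "with_proj (line_graph G)" by (rule line_graph_graph)
  let ?K = "(\<lambda>a. {tail G a, head G a}) ` out_arcs G v"
  have K: "?K \<subseteq> edge_set G"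
  proof
    fix e assume "e \<in> ?K"
    then obtain a where "a \<in> arcs G" "e = {tail G a, head G a}" by auto
    then show "e \<in> edge_set G" unfolding edge_set_def using in_arcs_imp_in_arcs_ends by blast
  qed
  have "out_degree G v = card ?K"
    unfolding out_degree_def by (rule card_image[OF inj_on_arc_ends, symmetric])
  also have "\<dots> \<le> 2 ^ metric_dimension (line_graph G)"
  proof (rule L.clique_card_le_power_metric_dimension[OF assms])
    show "?K \<subseteq> verts (line_graph G)" using K by (simp add: pverts_line_graph)
    fix x y assume "x \<in> ?K" "y \<in> ?K" "x \<noteq> y"
    then show "x \<rightarrow>\<^bsub>line_graph G\<^esub> y"
      using K unfolding line_graph_adj_iff by (auto simp: out_arcs_def)
  qed
  finally show ?thesis .
qed

lemma max_degree_le_power_metric_dimension: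
  assumes "Digraph_Component.connected (line_graph G)" "verts G \<noteq> {}"
  shows "max_degree G \<le> 2 ^ metric_dimension (line_graph G)"
  unfolding max_degree_def using assms out_degree_le_power_metric_dimension
  by (subst Max_le_iff) auto

end

section \<open>Edge sets that connect a set of vertices\<close>

text \<open>\<open>F\<close> connects \<open>S\<close> if no union of components of \<open>F\<close> splits \<open>S\<close>.\<close>

definition connects :: "'a set set \<Rightarrow> 'a set \<Rightarrow> bool" where
  "connects F S \<longleftrightarrow>
    (\<forall>C. C \<inter> S \<noteq> {} \<longrightarrow> (\<forall>f\<in>F. f \<inter> C \<noteq> {} \<longrightarrow> f \<subseteq> C) \<longrightarrow> S \<subseteq> C)"

lemma connectsD:
  assumes "connects F S" "C \<inter> S \<noteq> {}" "\<And>f. f \<in> F \<Longrightarrow> f \<inter> C \<noteq> {} \<Longrightarrow> f \<subseteq> C"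
  shows "S \<subseteq> C"
  using assms unfolding connects_def by blast

text \<open>A set closed under the new edge contains \<open>b\<close> exactly if it contains
  \<open>a\<close>, so if it meets \<open>insert b S\<close> it already meets
  \<open>S\<close>.\<close>

lemma connects_insert:
  assumes "connects F S" "a \<in> S"
  shows "connects (insert {a, b} F) (insert b S)"
  unfolding connects_def
proof (intro allI impI)
  fix C assume C: "C \<inter> insert b S \<noteq> {}"
    "\<forall>f\<in>insert {a, b} F. f \<inter> C \<noteq> {} \<longrightarrow> f \<subseteq> C"
  have ab: "a \<in> C \<longleftrightarrow> b \<in> C" using bspec[OF C(2) insertI1] by blast
  have "C \<inter> S \<noteq> {}" using C(1) ab assms(2) by blast
  then have "S \<subseteq> C" by (rule connectsD[OF assms(1)]) (use C(2) in simp)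
  then show "insert b S \<subseteq> C" using ab assms(2) by blast
qed

lemma connects_star:
  assumes "c \<in> S"
  shows "connects ((\<lambda>d. {c, d}) ` (S - {c})) S"
  unfolding connects_def
proof (intro allI impI)
  fix C assume C: "C \<inter> S \<noteq> {}"
    "\<forall>f\<in>(\<lambda>d. {c, d}) ` (S - {c}). f \<inter> C \<noteq> {} \<longrightarrow> f \<subseteq> C"
  have closed: "{c, d} \<subseteq> C" if "d \<in> S - {c}" "c \<in> C \<or> d \<in> C" for d
    using bspec[OF C(2) imageI[OF that(1)]] that(2) by blast
  have "c \<in> C" using C(1) closed by blast
  then show "S \<subseteq> C" using closed by blast
qed

text \<open>A tree is grown from a single vertex without edges: as long as vertices remain outside,
  a cut edge adds one vertex and at most one member of \<open>F\<close>.\<close>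

lemma (in graph) exists_connecting_edges:
  assumes "Digraph_Component.connected G" "1 \<le> k" "k \<le> card (verts G)"
  shows "\<exists>S F. S \<subseteq> verts G \<and> card S = k \<and> F \<subseteq> edge_set G \<and> finite F \<and> card F < k \<and> \<Union>F \<subseteq> S
    \<and> connects F S"
  using assms(2,3)
proof (induct k rule: dec_induct)
  case base
  then obtain v where "v \<in> verts G" by fastforce
  then show ?case
    by (intro exI[of _ "{v}"] exI[of _ "{}"]) (auto simp: connects_def)
next
  case (step k)
  then obtain S F where S: "S \<subseteq> verts G" "card S = k" "F \<subseteq> edge_set G" "finite F" "card F < k"
    "\<Union>F \<subseteq> S" "connects F S"
    by auto
  have "S \<noteq> verts G" "S \<noteq> {}" using S step by auto
  then obtain a b where ab: "a \<in> S" "b \<in> verts G" "b \<notin> S" "a \<rightarrow>\<^bsub>G\<^esub> b"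
    using connected_cut_edge[OF assms(1), of S] S(1) by blast
  have "finite S" using S(1) finite_verts finite_subset by blast
  moreover have "{a, b} \<in> edge_set G" using ab by (auto simp: edge_set_def)
  moreover have "card (insert {a, b} F) < Suc k"
    using S(4,5) by (simp add: card_insert_if)
  ultimately show ?case
    using S ab connects_insert[OF S(7) ab(1), of b]
    by (intro exI[of _ "insert b S"] exI[of _ "insert {a, b} F"]) auto
qed

section \<open>Pairs of edges that touch the same members of a connecting set\<close>

text \<open>An edge \<open>f\<close> joining a vertex of \<open>e - e'\<close> to a vertex of \<open>e\<close> would be \<open>e\<close> itself, so \<open>f\<close>
  joins \<open>e - e'\<close> to \<open>e' - e\<close>.\<close>

lemma sym_diff_closed:
  assumes "card e = 2" "card e' = 2" "card f = 2" "f \<noteq> e" "f \<noteq> e'"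
    and "f \<inter> e \<noteq> {} \<longleftrightarrow> f \<inter> e' \<noteq> {}"
    and "f \<inter> ((e - e') \<union> (e' - e)) \<noteq> {}"
  shows "f \<subseteq> (e - e') \<union> (e' - e)"
proof -
  have closed: "f \<subseteq> (g - g') \<union> (g' - g)"
    if g: "card g = 2" "f \<noteq> g" "f \<inter> g' \<noteq> {}" and a: "a \<in> f" "a \<in> g - g'" for g g' a
  proof -
    obtain b where b: "b \<in> f" "b \<in> g'" using g by blast
    have fin: "finite f" "finite g" using assms(3) g(1) by (auto intro: card_ge_0_finite)
    have "a \<noteq> b" using a b by blast
    then have f: "f = {a, b}"
      using card_subset_eq[OF fin(1), of "{a, b}"] a b assms(3) by simp
    have "b \<notin> g"
    proof
      assume "b \<in> g"
      then have "f = g"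
        using card_subset_eq[OF fin(2), of f] f a assms(3) g(1) by simp
      then show False using g(2) by contradiction
    qed
    then show ?thesis using f a b by blast
  qed
  consider a where "a \<in> f" "a \<in> e - e'" | a where "a \<in> f" "a \<in> e' - e"
    using assms(7) by blast
  then show ?thesis
  proof cases
    case 1
    then show ?thesis using closed[of e e'] assms by blast
  next
    case 2
    then show ?thesis using closed[of e' e] assms by blast
  qed
qed

context graph
begin

lemma unresolved_edges_cover:
  assumes F: "F \<subseteq> edge_set G" "connects F S"
    and S: "S \<subseteq> verts G" "card S + 1 = card (verts G)" "card S \<ge> 4"
    and e: "e \<in> edge_set G" "e' \<in> edge_set G" "e \<noteq> e'" "e \<notin> F" "e' \<notin> F"
    and eq: "\<And>f. f \<in> F \<Longrightarrow> f \<inter> e \<noteq> {} \<longleftrightarrow> f \<inter> e' \<noteq> {}"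
  shows "S = e \<union> e'" "e \<inter> e' = {}"
proof -
  let ?C = "(e - e') \<union> (e' - e)"
  have c2: "card e = 2" "card e' = 2" using card_edge e by auto
  then have fin: "finite e" "finite e'" by (auto intro: card_ge_0_finite)
  have finS: "finite S" using S(3) by (auto intro: card_ge_0_finite)
  have "card (verts G - S) = 1"
    using S finS by (simp add: card_Diff_subset)
  \<comment> \<open>Only one vertex lies outside \<open>S\<close>, so two elements suffice to make
    the symmetric difference meet \<open>S\<close>.\<close>
  have C2: "card ?C \<ge> 2"
  proof -
    have "e - e' \<noteq> {}" "e' - e \<noteq> {}"
      using e(3) c2 fin by (metis Diff_eq_empty_iff card_subset_eq)+
    then have "card (e - e') \<ge> 1" "card (e' - e) \<ge> 1"
      using fin by (auto simp: Suc_le_eq card_gt_0_iff)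
    moreover have "card ?C = card (e - e') + card (e' - e)"
      using fin by (intro card_Un_disjoint) auto
    ultimately show ?thesis by linarith
  qed
  have "?C \<inter> S \<noteq> {}"
  proof
    assume "?C \<inter> S = {}"
    then have "?C \<subseteq> verts G - S" using edge_subset_verts e by blast
    then have "card ?C \<le> 1"
      using \<open>card (verts G - S) = 1\<close> by (metis card_mono finite_Diff finite_verts)
    then show False using C2 by linarith
  qed
  moreover have "f \<subseteq> ?C" if "f \<in> F" "f \<inter> ?C \<noteq> {}" for f
  proof (rule sym_diff_closed)
    show "card f = 2" using that F card_edge by blast
  qed (use that c2 e eq in auto)
  ultimately have sub: "S \<subseteq> ?C" by (rule connectsD[OF F(2)])
  \<comment> \<open>As \<open>S\<close> has at least four elements and lies in
    \<open>e \<union> e'\<close>, this count leaves no room for a common vertex or for a vertex of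
    \<open>e \<union> e'\<close> outside \<open>S\<close>.\<close>
  have U: "card (e \<union> e') + card (e \<inter> e') = 4"
    using card_Un_Int[OF fin] c2 by simp
  have SU: "card S \<le> card (e \<union> e')" using sub fin by (intro card_mono) auto
  then have "card (e \<inter> e') = 0" using U S(3) by linarith
  then show "e \<inter> e' = {}" using fin by simp
  have "card S = card (e \<union> e')" using SU U S(3) by linarith
  then show "S = e \<union> e'"
    using sub fin by (intro card_subset_eq) auto
qed

text \<open>Members of \<open>F\<close> lie in the four-element set \<open>S\<close> and differ from
  \<open>e\<close> and \<open>e'\<close>, so each of them crosses between the two. Two crossing
  edges with a common end, together with whichever of \<open>e\<close> and \<open>e'\<close>
  contains that end, form the star.\<close>

lemma unresolved_edges_center:
  assumes F: "F \<subseteq> edge_set G" "connects F S" "\<Union>F \<subseteq> S"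
    and e: "e \<in> edge_set G" "e' \<in> edge_set G" "e \<notin> F" "e' \<notin> F"
    and S: "S = e \<union> e'" "e \<inter> e' = {}"
  obtains c where "c \<in> S" "\<And>d. d \<in> S \<Longrightarrow> d \<noteq> c \<Longrightarrow> {c, d} \<in> edge_set G"
proof -
  obtain u v where uv: "e = {u, v}" "u \<noteq> v" using e by (blast elim: edge_setE)
  obtain x y where xy: "e' = {x, y}" "x \<noteq> y" using e by (blast elim: edge_setE)
  \<comment> \<open>Otherwise \<open>C\<close> would be closed under \<open>F\<close> and
    \<open>connects\<close> would force \<open>S \<subseteq> C\<close>.\<close>
  have step: "\<exists>a\<in>C. \<exists>b\<in>S - C. {a, b} \<in> F" if C: "C \<noteq> {}" "C \<subset> S" for C
  proof (rule ccontr)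
    assume neg: "\<not> ?thesis"
    have no: "b \<in> C" if "a \<in> C" "{a, b} \<in> F" for a b
      using that neg F(3) by blast
    have "S \<subseteq> C"
    proof (rule connectsD[OF F(2)])
      show "C \<inter> S \<noteq> {}" using C by blast
      fix f assume f: "f \<in> F" "f \<inter> C \<noteq> {}"
      then obtain a b where ab: "f = {a, b}" using F(1) by (blast elim: edge_setE)
      then have "{a, b} \<in> F" "{b, a} \<in> F" using f by (simp_all add: insert_commute)
      then show "f \<subseteq> C" using f(2) ab no by blast
    qed
    then show False using C by blast
  qed
  have "{u} \<subset> S" using S uv xy by blast
  then obtain b where b: "b \<in> S" "b \<noteq> u" "{u, b} \<in> F" using step[of "{u}"] by blast
  then have "b \<in> e'" using S uv e by auto
  then obtain z where z: "e' = {b, z}" "z \<noteq> b" using xy by auto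
  have "{u, b} \<subset> S" using S uv z by auto
  then obtain p q where pq: "p \<in> {u, b}" "q \<in> S - {u, b}" "{p, q} \<in> F"
    using step[of "{u, b}"] by blast
  \<comment> \<open>With \<open>q\<close> being \<open>v\<close> or \<open>z\<close>, the other two
    combinations would make \<open>{p, q}\<close> equal to \<open>e\<close> or \<open>e'\<close>,
    neither of which is in \<open>F\<close>.\<close>
  consider "p = u" "q = z" | "p = b" "q = v"
    using pq S uv z e(3,4) by auto
  then show thesis
  proof cases
    case 1
    have "{u, d} \<in> edge_set G" if "d \<in> S" "d \<noteq> u" for d
    proof -
      have "d = v \<or> d = b \<or> d = z" using that S(1) uv(1) z(1) by blast
      then have "{u, d} = e \<or> {u, d} \<in> F" using uv(1) b(3) pq(3) 1 by blast
      then show ?thesis using e(1) F(1) by blast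
    qed
    then show thesis using that \<open>{u} \<subset> S\<close> by blast
  next
    case 2
    have "{b, d} \<in> edge_set G" if "d \<in> S" "d \<noteq> b" for d
    proof -
      have "d = u \<or> d = v \<or> d = z" using that S(1) uv(1) z(1) by blast
      then have "{b, d} = e' \<or> {b, d} \<in> F"
        using z(1) b(3) pq(3) 2 by (metis insert_commute)
      then show ?thesis using e(2) F(1) by blast
    qed
    then show thesis using that b(1) by blast
  qed
qed

section \<open>Small resolving sets of the line graph\<close>

text \<open>Distances 0 and 1 carry enough information: 0 identifies the members of
  \<open>F\<close>, and for an edge outside \<open>F\<close> the distance to \<open>f\<close> is 1
  exactly if it touches \<open>f\<close>. So only incidences have to be compared.\<close>

lemma resolving_set_line_graphI:
  assumes conn: "Digraph_Component.connected (line_graph G)"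
    and F: "F \<subseteq> edge_set G" "finite F"
    and sep: "\<And>e e'. e \<in> edge_set G \<Longrightarrow> e' \<in> edge_set G \<Longrightarrow> e \<noteq> e' \<Longrightarrow> e \<notin> F \<Longrightarrow> e' \<notin> F
      \<Longrightarrow> (\<And>f. f \<in> F \<Longrightarrow> f \<inter> e \<noteq> {} \<longleftrightarrow> f \<inter> e' \<noteq> {}) \<Longrightarrow> False"
  shows "resolving_set (line_graph G) F"
proof -
  interpret L: graph "with_proj (line_graph G)" by (rule line_graph_graph)
  have "e = e'" if e: "e \<in> edge_set G" "e' \<in> edge_set G"
    and eq: "(\<lambda>w\<in>F. graph_dist (line_graph G) e w)
      = (\<lambda>w\<in>F. graph_dist (line_graph G) e' w)" for e e'
  proof (rule ccontr)
    assume ne: "e \<noteq> e'"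
    have d: "graph_dist (line_graph G) e w = graph_dist (line_graph G) e' w"
      if "w \<in> F" for w using fun_cong[OF eq, of w] that by simp
    have FV: "w \<in> verts (line_graph G)" if "w \<in> F" for w
      using that F by (auto simp: pverts_line_graph)
    have eV: "e \<in> verts (line_graph G)" "e' \<in> verts (line_graph G)"
      using e by (auto simp: pverts_line_graph)
    have zero: "e = w \<longleftrightarrow> e' = w" if "w \<in> F" for w
      using L.graph_dist_eq_0_iff[OF conn eV(1) FV[OF that]]
        L.graph_dist_eq_0_iff[OF conn eV(2) FV[OF that]] d[OF that] by simp
    then have nF: "e \<notin> F" "e' \<notin> F" using ne by auto
    have "f \<inter> e \<noteq> {} \<longleftrightarrow> f \<inter> e' \<noteq> {}" if f: "f \<in> F" for f
    proof -
      have "e \<rightarrow>\<^bsub>line_graph G\<^esub> f \<longleftrightarrow> e' \<rightarrow>\<^bsub>line_graph G\<^esub> f"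
        using L.graph_dist_eq_1_iff[OF conn eV(1) FV[OF f]]
          L.graph_dist_eq_1_iff[OF conn eV(2) FV[OF f]] d[OF f] by simp
      then show ?thesis using e f nF F(1) unfolding line_graph_adj_iff by blast
    qed
    then show False by (rule sep[OF e ne nF])
  qed
  then show ?thesis
    using F by (auto simp: resolving_set_def pverts_line_graph intro: inj_onI)
qed

lemma exists_small_resolving_set_line_graph:
  assumes conn: "Digraph_Component.connected G" and n: "card (verts G) \<ge> 5"
  obtains F where "resolving_set (line_graph G) F" "card F + 2 \<le> card (verts G)"
proof -
  have Lconn: "Digraph_Component.connected (line_graph G)"
    using line_graph_connected[OF conn] edge_set_nonempty[OF conn] n by simp
  \<comment> \<open>Leaving out one vertex gives a connecting set with fewer than
    \<open>card (verts G) - 1\<close> edges, hence at most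
    \<open>card (verts G) - 2\<close>.\<close>
  have "1 \<le> card (verts G) - 1" "card (verts G) - 1 \<le> card (verts G)" using n by auto
  from exists_connecting_edges[OF conn this]
  obtain S F where SF: "S \<subseteq> verts G" "card S = card (verts G) - 1" "F \<subseteq> edge_set G" "finite F"
    "card F < card (verts G) - 1" "\<Union>F \<subseteq> S" "connects F S"
    by blast
  have S: "card S + 1 = card (verts G)" "card S \<ge> 4" using SF n by auto
  show thesis
  proof (cases "resolving_set (line_graph G) F")
    case True
    then show thesis using that SF(5) by simp
  next
    case False
    then obtain e e' where e: "e \<in> edge_set G" "e' \<in> edge_set G" "e \<noteq> e'" "e \<notin> F" "e' \<notin> F"
      and eq: "\<And>f. f \<in> F \<Longrightarrow> f \<inter> e \<noteq> {} \<longleftrightarrow> f \<inter> e' \<noteq> {}"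
      using resolving_set_line_graphI[OF Lconn SF(3,4)] by metis
    note cover = unresolved_edges_cover[OF SF(3,7,1) S e eq]
    obtain c where c: "c \<in> S" "\<And>d. d \<in> S \<Longrightarrow> d \<noteq> c \<Longrightarrow> {c, d} \<in> edge_set G"
      using unresolved_edges_center[OF SF(3,7,6) e(1,2,4,5) cover(1,2)] by blast
    let ?F = "(\<lambda>d. {c, d}) ` (S - {c})"
    have finS: "finite S" using SF(1) finite_verts finite_subset by blast
    have sub: "?F \<subseteq> edge_set G" using c by auto
    have "resolving_set (line_graph G) ?F"
    proof (rule resolving_set_line_graphI[OF Lconn sub])
      show "finite ?F" using finS by simp
      fix g g' assume g: "g \<in> edge_set G" "g' \<in> edge_set G" "g \<noteq> g'" "g \<notin> ?F" "g' \<notin> ?F"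
        and geq: "\<And>f. f \<in> ?F \<Longrightarrow> f \<inter> g \<noteq> {} \<longleftrightarrow> f \<inter> g' \<noteq> {}"
      have Sg: "S = g \<union> g'"
        using unresolved_edges_cover(1)[OF sub connects_star[OF c(1)] SF(1) S g geq] .
      \<comment> \<open>By \<open>Sg\<close> both edges lie in \<open>S\<close> and one of them
        contains \<open>c\<close>; that one is then a member of the star, although neither
        was.\<close>
      have "h \<in> ?F" if "h \<in> edge_set G" "c \<in> h" "h \<subseteq> S" for h
        using that by (auto elim!: edge_setE simp: insert_commute)
      then show False using Sg g c(1) by blast
    qed
    moreover have "card ?F + 2 \<le> card (verts G)"
      using card_image_le[of "S - {c}" "\<lambda>d. {c, d}"] finS c(1) S
      by (simp add: card_Diff_singleton)
    ultimately show thesis using that by blast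
  qed
qed

end

theorem theorem3p1:
  fixes G :: "('a, 'b) pre_digraph"
  assumes "graph G"
    and "Digraph_Component.connected G"
    and "card (verts G) \<ge> 5"
  shows "\<lceil>log 2 (real (max_degree G))\<rceil> \<le> int (metric_dimension (line_graph G))
    \<and> int (metric_dimension (line_graph G)) \<le> int (card (verts G)) - 2"
proof
  interpret graph G by fact
  interpret L: graph "with_proj (line_graph G)" by (rule line_graph_graph)
  let ?m = "metric_dimension (line_graph G)"
  have "edge_set G \<noteq> {}" using edge_set_nonempty assms by simp
  then have Lconn: "Digraph_Component.connected (line_graph G)"
    using line_graph_connected assms by blast
  have "max_degree G \<le> 2 ^ ?m"
    using max_degree_le_power_metric_dimension[OF Lconn] assms(3) by fastforce
  then have le: "real (max_degree G) \<le> 2 ^ ?m"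
    by (metis of_nat_le_iff of_nat_numeral of_nat_power)
  have "log 2 (real (max_degree G)) \<le> real ?m"
  proof (cases "max_degree G = 0")
    \<comment> \<open>By convention \<open>log 2 0\<close> is 0, so the bound also holds
      here.\<close>
    case True
    then show ?thesis by (simp add: log_def)
  next
    case False
    then have "log 2 (real (max_degree G)) \<le> log 2 (2 ^ ?m)"
      using le by (subst log_le_cancel_iff) auto
    then show ?thesis by simp
  qed
  then show "\<lceil>log 2 (real (max_degree G))\<rceil> \<le> int ?m" by (simp add: ceiling_le_iff)
  obtain F where "resolving_set (line_graph G) F" "card F + 2 \<le> card (verts G)"
    using exists_small_resolving_set_line_graph assms by blast
  then show "int ?m \<le> int (card (verts G)) - 2"
    using L.metric_dimension_le by fastforce
qed

end
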